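(* Let $D\subseteq\mathbb{R}^n$ be an open set with $0\in D$, let $f:D\to\mathbb{R}^n$ be a locally Lipschitz mapping with $f(0)=0$, and consider the dynamical system $\dot{x}=f(x)$, $x\in D$. Suppose that $0$ is locally exponentially stable, i.e., there exist constants $\rho,\omega>0$ and $M\ge 1$ such that for every $x_0\in D$ with $|x_0|\le\rho$ the solution $x(t)$ of the initial-value problem $\dot{x}=f(x)$, $x(0)=x_0$ satisfies $$|x(t)|\le M\exp(-\omega t)|x_0|\quad\text{for all } t\ge 0.$$ Moreover, suppose that $0$ is uniformly globally asymptotically stable, i.e., there exist $\sigma\in KL$ and a size function $\varphi:D\to\mathbb{R}_+$ with $\varphi(0)=0$ such that for every $x_0\in D$ the solution $x(t)$ of the initial-value problem $\dot{x}=f(x)$, $x(0)=x_0$ satisfies $$|x(t)|\le\sigma(\varphi(x_0),t)\quad\text{for all } t\ge 0.$$ Then there exists a size function $\kappa:D\to\mathbb{R}_+$ with $\kappa(0)=0$ such that for every $x_0\in D$ the solution $x(t)$ of the initial-value problem $\dot{x}=f(x)$, $x(0)=x_0$ satisfies $$|x(t)|\le\exp(-\omega t)\kappa(x_0)\quad\text{for all } t\ge 0,$$ with the same constant $\omega$ as in the local exponential stability estimate.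
   Context: $\mathbb{R}_+=[0,+\infty)$ and $|\cdot|$ is the Euclidean norm. A size function for $\dot{x}=f(x)$, $x\in D$, is a continuous function $\varphi:D\to\mathbb{R}_+$ such that for every $r>\inf(\varphi(D))$ the set $\{x\in D:\varphi(x)\le r\}$ is compact. Class $K$: increasing continuous functions $a:\mathbb{R}_+\to\mathbb{R}_+$ with $a(0)=0$. Class $KL$: continuous functions $\sigma:\mathbb{R}_+\times\mathbb{R}_+\to\mathbb{R}_+$ such that for each $t\ge 0$ the mapping $\sigma(\cdot,t)$ is of class $K$, and for each $s\ge 0$ the mapping $\sigma(s,\cdot)$ is non-increasing with $\lim_{t\to+\infty}\sigma(s,t)=0$. The stability estimates "for all $t\ge0$" include that the solution is defined (in $D$) for all $t\ge 0$. *)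

theory Defs
  imports "HOL-Analysis.Analysis"
begin

definition size_function :: "'a::metric_space set \<Rightarrow> ('a \<Rightarrow> real) \<Rightarrow> bool" where
  "size_function D \<phi> \<longleftrightarrow>
     continuous_on D \<phi> \<and> (\<forall>x\<in>D. 0 \<le> \<phi> x) \<and>
     (\<forall>r > Inf (\<phi> ` D). compact {x \<in> D. \<phi> x \<le> r})"

text \<open>
  Functions on the nonnegative half-line are represented by total functions of which only the
  values at nonnegative arguments matter. \<open>Increasing\<close> is read strictly,
  in contrast to \<open>non-increasing\<close>.
\<close>

definition class_K :: "(real \<Rightarrow> real) \<Rightarrow> bool" where
  "class_K a \<longleftrightarrow>
     continuous_on {0..} a \<and> strict_mono_on {0..} a \<and> a \<in> {0..} \<rightarrow> {0..} \<and> a 0 = 0"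

definition class_KL :: "(real \<Rightarrow> real \<Rightarrow> real) \<Rightarrow> bool" where
  "class_KL \<sigma> \<longleftrightarrow>
     continuous_on ({0..} \<times> {0..}) (\<lambda>(s, t). \<sigma> s t) \<and>
     (\<forall>s\<ge>0. \<forall>t\<ge>0. 0 \<le> \<sigma> s t) \<and>
     (\<forall>t\<ge>0. class_K (\<lambda>s. \<sigma> s t)) \<and>
     (\<forall>s\<ge>0. antimono_on {0..} (\<sigma> s) \<and> (\<sigma> s \<longlongrightarrow> 0) at_top)"

text \<open>
  \<open>x\<close> solves the autonomous initial-value problem on the whole of \<open>[0, \<infinity>)\<close> and stays in \<open>D\<close>;
  at time \<open>0\<close> the derivative is one-sided.
\<close>

definition global_solution ::
    "('a::real_normed_vector \<Rightarrow> 'a) \<Rightarrow> 'a set \<Rightarrow> 'a \<Rightarrow> (real \<Rightarrow> 'a) \<Rightarrow> bool" where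
  "global_solution f D x0 x \<longleftrightarrow>
     x 0 = x0 \<and>
     (\<forall>t\<ge>0. x t \<in> D \<and> (x has_vector_derivative f (x t)) (at t within {0..}))"

text \<open>
  The solution starting at \<open>x0\<close> exists for all \<open>t \<ge> 0\<close> and its norm is bounded by \<open>b\<close>.
  For locally Lipschitz \<open>f\<close> the solution is unique on \<open>[0, \<infinity>)\<close>, so the universal quantifier
  only ranges over representatives of one function; the first conjunct excludes vacuity.
\<close>

definition solution_bounded_by ::
    "('a::real_normed_vector \<Rightarrow> 'a) \<Rightarrow> 'a set \<Rightarrow> 'a \<Rightarrow> (real \<Rightarrow> real) \<Rightarrow> bool" where
  "solution_bounded_by f D x0 b \<longleftrightarrow>
     (\<exists>x. global_solution f D x0 x) \<and>
     (\<forall>x. global_solution f D x0 x \<longrightarrow> (\<forall>t\<ge>0. norm (x t) \<le> b t))"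

end

theory Submission
  imports Defs
begin

text \<open>
  The quantity to be majorised is the worst weighted norm
  \<open>V(x0) = sup {exp (\<omega> t) |x(t)| : t \<ge> 0}\<close> along the solution from \<open>x0\<close>.
  Near the origin local exponential stability gives \<open>V(x0) \<le> M |x0|\<close>. Elsewhere it is enough
  that \<open>V\<close> is bounded on every sublevel set \<open>\<phi> \<le> r\<close>
  (\<open>weighted_norm_bounded_on_sublevel\<close>): at some time \<open>T\<close> that depends only on \<open>r\<close> all solutions
  from this set lie in the ball of radius \<open>\<rho>\<close>, up to \<open>T\<close> they are bounded by
  \<open>\<sigma>(r, 0)\<close>, and from then on they decay at the exact rate \<open>\<omega>\<close>; the delay \<open>T\<close> only costs the
  factor \<open>exp (\<omega> T)\<close>.

  A function \<open>V\<close>, continuous or not, that is bounded on the sublevel sets of \<open>\<phi>\<close>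
  lies below \<open>G \<circ> \<phi>\<close> for some continuous \<open>G \<ge> 0\<close>
  (\<open>continuous_majorant_of_sublevel_bounded\<close>), and
  \<open>\<kappa>(x) = \<phi>(x) + M |x| + (|x| / \<rho>) G(\<phi>(x))\<close> combines the two bounds: the second summand
  dominates \<open>V\<close> in the ball of radius \<open>\<rho>\<close>, the third one outside it, both vanish at \<open>0\<close>, and
  the first summand makes the sublevel sets compact.
\<close>

lemma global_solution_shift:
  assumes "global_solution f D x0 x" and "0 \<le> T"
  shows "global_solution f D (x T) (\<lambda>t. x (T + t))"
  unfolding global_solution_def
proof (intro conjI allI impI)
  fix t :: real assume t: "0 \<le> t"
  show "x (T + t) \<in> D"
    using assms t by (simp add: global_solution_def)
  have "(x has_vector_derivative f (x (T + t))) (at (T + t) within {0..})"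
    using assms t by (simp add: global_solution_def)
  then have "(x has_vector_derivative f (x (T + t))) (at (T + t) within (+) T ` {0..})"
    by (rule has_vector_derivative_within_subset) (use assms(2) in auto)
  then have "(x has_derivative (\<lambda>h. h *\<^sub>R f (x (T + t)))) (at (T + t) within (+) T ` {0..})"
    by (simp add: has_vector_derivative_def)
  moreover have "((+) T has_derivative (\<lambda>h. h)) (at t within {0..})"
    by (auto intro!: derivative_eq_intros)
  ultimately have "((\<lambda>s. x (T + s)) has_derivative (\<lambda>h. h *\<^sub>R f (x (T + t)))) (at t within {0..})"
    using has_derivative_in_compose by blast
  then show "((\<lambda>s. x (T + s)) has_vector_derivative f (x (T + t))) (at t within {0..})"
    by (simp add: has_vector_derivative_def)
qed simp

text \<open>
  The unit-length moving average \<open>g r = \<integral>[r, r + 1] B\<close> looks only to the right, so it stays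
  above a nondecreasing \<open>B\<close>, and averaging removes the jumps.
\<close>

lemma continuous_majorant_of_mono:
  fixes B :: "real \<Rightarrow> real"
  assumes "mono B"
  obtains g where "continuous_on {0..} g" "\<And>r. 0 \<le> r \<Longrightarrow> B r \<le> g r"
proof
  define F where "F = (\<lambda>s. integral {0..s} B)"
  have int: "B integrable_on {a..b}" for a b
    using assms by (intro integrable_on_mono_on) (auto simp: mono_on_def mono_def)
  have F: "continuous_on {0..} F"
  proof (clarsimp simp: continuous_on_eq_continuous_within)
    fix s :: real assume s: "0 \<le> s"
    have "continuous_on {0..s + 1} F"
      unfolding F_def by (rule indefinite_integral_continuous_1[OF int])
    then have "continuous (at s within {0..s + 1}) F"
      using s by (simp add: continuous_on_eq_continuous_within)
    moreover have "at s within {0..s + 1} = at s within {0..}"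
      by (rule at_within_nhd[of _ "{..<s + 1}"]) auto
    ultimately show "continuous (at s within {0..}) F"
      by (simp add: continuous_within)
  qed
  show "continuous_on {0..} (\<lambda>r. F (r + 1) - F r)"
    by (intro continuous_intros continuous_on_compose2[OF F]) auto
  fix r :: real assume r: "0 \<le> r"
  have "B r = integral {r..r + 1} (\<lambda>_. B r)"
    by simp
  also have "\<dots> \<le> integral {r..r + 1} B"
    using assms by (intro integral_le int) (auto simp: mono_def)
  also have "\<dots> = F (r + 1) - F r"
    using Henstock_Kurzweil_Integration.integral_combine[OF r _ int, of "r + 1"]
    by (simp add: F_def)
  finally show "B r \<le> F (r + 1) - F r" .
qed

lemma continuous_majorant_of_sublevel_bounded:
  fixes h V :: "'i \<Rightarrow> real"
  assumes "\<And>r. bdd_above (V ` {i \<in> I. h i \<le> r})"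
  obtains g where "continuous_on {0..} g" "\<And>r. 0 \<le> r \<Longrightarrow> 0 \<le> g r"
    "\<And>i. i \<in> I \<Longrightarrow> 0 \<le> h i \<Longrightarrow> V i \<le> g (h i)"
proof -
  \<comment> \<open>Inserting \<open>0\<close> makes the suprema nonnegative and keeps empty sublevel sets harmless.\<close>
  define S where "S r = insert 0 (V ` {i \<in> I. h i \<le> r})" for r
  have bdd: "bdd_above (S r)" for r
    using assms by (simp add: S_def)
  have "mono (\<lambda>r. Sup (S r))"
    by (intro monoI cSup_subset_mono bdd) (auto simp: S_def)
  then obtain g where g: "continuous_on {0..} g" "\<And>r. 0 \<le> r \<Longrightarrow> Sup (S r) \<le> g r"
    using continuous_majorant_of_mono by blast
  have upper: "v \<le> g r" if "v \<in> S r" "0 \<le> r" for v r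
    using cSup_upper[OF that(1) bdd] g(2)[OF that(2)] by linarith
  show thesis
    by (rule that[OF g(1)]) (auto intro!: upper simp: S_def)
qed

text \<open>
  All constants in the bound depend on \<open>r\<close> only, because \<open>\<sigma>\<close> is nondecreasing in its first
  argument: a time \<open>T\<close> at which the ball of radius \<open>\<rho>\<close> is reached can be read off from \<open>\<sigma>(r, \<cdot>)\<close>.
\<close>

lemma weighted_norm_bounded_on_sublevel:
  fixes f :: "'a::real_normed_vector \<Rightarrow> 'a"
  assumes "0 < \<rho>" "0 \<le> \<omega>" "0 \<le> M" and KL: "class_KL \<sigma>"
    and les: "\<And>x0. x0 \<in> D \<Longrightarrow> norm x0 \<le> \<rho> \<Longrightarrow>
           solution_bounded_by f D x0 (\<lambda>t. M * exp (- \<omega> * t) * norm x0)"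
    and gas: "\<And>x0. x0 \<in> D \<Longrightarrow> solution_bounded_by f D x0 (\<lambda>t. \<sigma> (\<phi> x0) t)"
    and nonneg: "\<And>x0. x0 \<in> D \<Longrightarrow> 0 \<le> \<phi> x0"
  obtains b where "\<And>x0 x t. x0 \<in> D \<Longrightarrow> \<phi> x0 \<le> r \<Longrightarrow> global_solution f D x0 x \<Longrightarrow> 0 \<le> t \<Longrightarrow>
    exp (\<omega> * t) * norm (x t) \<le> b"
proof (cases "0 \<le> r")
  case False
  then show thesis
    using that nonneg by (meson order_trans)
next
  case r: True
  have "(\<sigma> r \<longlongrightarrow> 0) at_top"
    using KL r by (auto simp: class_KL_def)
  then have "\<forall>\<^sub>F t in at_top. \<sigma> r t < \<rho>"
    using assms(1) by (rule order_tendstoD)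
  then have "\<forall>\<^sub>F t in at_top. \<sigma> r t < \<rho> \<and> 0 \<le> t"
    using eventually_ge_at_top by (rule eventually_conj)
  then obtain T where T: "\<sigma> r T < \<rho>" "0 \<le> T"
    using eventually_happens'[OF trivial_limit_at_top_linorder] by blast
  show thesis
  proof (rule that[of "exp (\<omega> * T) * max (\<sigma> r 0) (M * \<rho>)"])
    fix x0 x t
    assume x0: "x0 \<in> D" "\<phi> x0 \<le> r" and x: "global_solution f D x0 x" and t: "(0::real) \<le> t"
    have bound: "norm (x s) \<le> \<sigma> r s" if "0 \<le> s" for s
    proof -
      have "norm (x s) \<le> \<sigma> (\<phi> x0) s"
        using gas[OF x0(1)] x that by (simp add: solution_bounded_by_def)
      also have "strict_mono_on {0..} (\<lambda>u. \<sigma> u s)"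
        using KL that by (simp add: class_KL_def class_K_def)
      then have "\<sigma> (\<phi> x0) s \<le> \<sigma> r s"
        by (rule strict_mono_on_leD) (use x0 nonneg r in auto)
      finally show ?thesis .
    qed
    show "exp (\<omega> * t) * norm (x t) \<le> exp (\<omega> * T) * max (\<sigma> r 0) (M * \<rho>)"
    proof (cases "t \<le> T")
      case True
      have "antimono_on {0..} (\<sigma> r)"
        using KL r by (simp add: class_KL_def)
      then have "\<sigma> r t \<le> \<sigma> r 0"
        using t by (auto simp: monotone_on_def)
      then have "norm (x t) \<le> max (\<sigma> r 0) (M * \<rho>)"
        using bound[OF t] by linarith
      then show ?thesis
        using True assms(2) by (intro mult_mono) (auto intro: mult_left_mono)
    next
      case False
      have xT: "x T \<in> D" "norm (x T) \<le> \<rho>"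
        using x T bound[OF T(2)] by (auto simp: global_solution_def)
      have "norm (x (T + (t - T))) \<le> M * exp (- \<omega> * (t - T)) * norm (x T)"
        using les[OF xT, unfolded solution_bounded_by_def, THEN conjunct2, rule_format,
            OF global_solution_shift[OF x T(2)], of "t - T"] False
        by simp
      also have "\<dots> \<le> M * exp (- \<omega> * (t - T)) * \<rho>"
        using xT(2) assms(3) by (intro mult_left_mono) auto
      finally have "exp (\<omega> * t) * norm (x t) \<le> exp (\<omega> * t) * (M * exp (- \<omega> * (t - T)) * \<rho>)"
        by (simp add: mult_left_mono)
      also have "\<dots> = exp (\<omega> * T) * (M * \<rho>)"
        by (simp add: algebra_simps flip: exp_add)
      also have "\<dots> \<le> exp (\<omega> * T) * max (\<sigma> r 0) (M * \<rho>)"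
        by (intro mult_left_mono) auto
      finally show ?thesis .
    qed
  qed
qed

text \<open>
  Raising the function shrinks its sublevel sets, and by continuity they are
  relatively closed in the compact sublevel sets of the given size function.
\<close>

lemma size_function_majorant:
  assumes "size_function D \<phi>" "continuous_on D \<kappa>" "0 \<in> D" "\<phi> 0 = 0" "\<kappa> 0 = 0"
    and le: "\<And>x. x \<in> D \<Longrightarrow> \<phi> x \<le> \<kappa> x"
  shows "size_function D \<kappa>"
proof -
  have nonneg: "0 \<le> \<phi> x" "0 \<le> \<kappa> x" if "x \<in> D" for x
    using assms(1) le that by (force simp: size_function_def)+
  \<comment> \<open>Both functions attain the infimum \<open>0\<close> at the origin, so the same levels \<open>r\<close> qualify.\<close>
  have Inf: "Inf (\<phi> ` D) = 0" "Inf (\<kappa> ` D) = 0"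
    using assms(3-5) nonneg by (auto intro!: cInf_eq_minimum rev_image_eqI)
  have "compact {x \<in> D. \<kappa> x \<le> r}" if "r > 0" for r
  proof -
    let ?S = "{x \<in> D. \<phi> x \<le> r}"
    have S: "compact ?S"
      using assms(1) Inf(1) that by (simp add: size_function_def)
    have "closed (?S \<inter> \<kappa> -` {..r})"
      by (intro continuous_closed_preimage continuous_on_subset[OF assms(2)])
        (auto intro: compact_imp_closed[OF S])
    with S have "compact (?S \<inter> (?S \<inter> \<kappa> -` {..r}))"
      by (rule compact_Int_closed)
    also have "?S \<inter> (?S \<inter> \<kappa> -` {..r}) = {x \<in> D. \<kappa> x \<le> r}"
      using le by force
    finally show ?thesis .
  qed
  then show ?thesis
    using assms(2) nonneg(2) Inf(2) by (simp add: size_function_def)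
qed

theorem theorem1:
  fixes D :: "(real ^ 'n) set" and f :: "real ^ 'n \<Rightarrow> real ^ 'n"
    and \<rho> \<omega> M :: real
  assumes "open D" and "0 \<in> D"
    and "local_lipschitz UNIV D (\<lambda>_::real. f)" and "f 0 = 0"
    and "\<rho> > 0" and "\<omega> > 0" and "M \<ge> 1"
    and "\<forall>x0\<in>D. norm x0 \<le> \<rho> \<longrightarrow>
           solution_bounded_by f D x0 (\<lambda>t. M * exp (- \<omega> * t) * norm x0)"
    and "\<exists>\<sigma> \<phi>. class_KL \<sigma> \<and> size_function D \<phi> \<and> \<phi> 0 = 0 \<and>
           (\<forall>x0\<in>D. solution_bounded_by f D x0 (\<lambda>t. \<sigma> (\<phi> x0) t))"
  shows "\<exists>\<kappa>. size_function D \<kappa> \<and> \<kappa> 0 = 0 \<and>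
           (\<forall>x0\<in>D. solution_bounded_by f D x0 (\<lambda>t. exp (- \<omega> * t) * \<kappa> x0))"
proof -
  obtain \<sigma> \<phi> where KL: "class_KL \<sigma>" and \<phi>: "size_function D \<phi>" "\<phi> 0 = 0"
    and gas: "\<And>x0. x0 \<in> D \<Longrightarrow> solution_bounded_by f D x0 (\<lambda>t. \<sigma> (\<phi> x0) t)"
    using assms(9) by blast
  note les = assms(8)[rule_format]
  have \<phi>_nonneg: "\<And>x. x \<in> D \<Longrightarrow> 0 \<le> \<phi> x" and \<phi>_cont: "continuous_on D \<phi>"
    using \<phi>(1) by (auto simp: size_function_def)
  \<comment> \<open>The index set consists of all pairs of a solution and a time, so that the supremum over
    time is taken together with the supremum over a sublevel set.\<close>
  define I where "I = {(x, t). x 0 \<in> D \<and> global_solution f D (x 0) x \<and> (0::real) \<le> t}"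
  define V where "V = (\<lambda>(x, t). exp (\<omega> * t) * norm (x t :: real ^ 'n))"
  define h where "h = (\<lambda>(x, t :: real). \<phi> (x (0::real)))"
  have "bdd_above (V ` {i \<in> I. h i \<le> r})" for r
  proof -
    obtain b where "\<And>x0 x t. x0 \<in> D \<Longrightarrow> \<phi> x0 \<le> r \<Longrightarrow> global_solution f D x0 x \<Longrightarrow> 0 \<le> t \<Longrightarrow>
        exp (\<omega> * t) * norm (x t) \<le> b"
      by (rule weighted_norm_bounded_on_sublevel[OF \<open>0 < \<rho>\<close> _ _ KL les gas \<phi>_nonneg, where r = r])
        (use assms(6,7) in auto)
    then show ?thesis
      by (intro bdd_aboveI[of _ b]) (auto simp: V_def I_def h_def)
  qed
  then obtain G where G: "continuous_on {0..} G" "\<And>r. 0 \<le> r \<Longrightarrow> 0 \<le> G r"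
    and V_le: "\<And>i. i \<in> I \<Longrightarrow> 0 \<le> h i \<Longrightarrow> V i \<le> G (h i)"
    using continuous_majorant_of_sublevel_bounded[of V I h] by blast
  define \<kappa> where "\<kappa> = (\<lambda>x. \<phi> x + M * norm x + norm x / \<rho> * G (\<phi> x))"
  have "continuous_on D \<kappa>"
    unfolding \<kappa>_def
    by (intro continuous_intros \<phi>_cont continuous_on_compose2[OF G(1) \<phi>_cont])
      (use \<phi>_nonneg assms(5) in auto)
  moreover have "\<phi> x \<le> \<kappa> x" if "x \<in> D" for x
    using G(2) \<phi>_nonneg[OF that] assms(5,7) by (simp add: \<kappa>_def)
  moreover have "\<kappa> 0 = 0"
    by (simp add: \<kappa>_def \<phi>(2))
  ultimately have size: "size_function D \<kappa>"
    using size_function_majorant[OF \<phi>(1)] \<phi>(2) assms(2) by blast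
  have "norm (x t) \<le> exp (- \<omega> * t) * \<kappa> x0"
    if x0: "x0 \<in> D" and x: "global_solution f D x0 x" and t: "0 \<le> t" for x0 x t
  proof -
    have "exp (\<omega> * t) * norm (x t) \<le> \<kappa> x0"
    proof (cases "norm x0 \<le> \<rho>")
      case True
      then have "norm (x t) \<le> M * exp (- \<omega> * t) * norm x0"
        using les[OF x0] x t by (simp add: solution_bounded_by_def)
      then have "exp (\<omega> * t) * norm (x t) \<le> exp (\<omega> * t) * (M * exp (- \<omega> * t) * norm x0)"
        by (intro mult_left_mono) auto
      also have "\<dots> = M * norm x0"
        by (simp flip: exp_add)
      also have "\<dots> \<le> \<kappa> x0"
        using G(2) \<phi>_nonneg[OF x0] assms(5) by (simp add: \<kappa>_def)
      finally show ?thesis .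
    next
      case False
      have start: "x 0 = x0"
        using x by (simp add: global_solution_def)
      then have "exp (\<omega> * t) * norm (x t) \<le> 1 * G (\<phi> x0)"
        using V_le[of "(x, t)"] x0 x t \<phi>_nonneg by (simp add: V_def I_def h_def)
      also have "\<dots> \<le> norm x0 / \<rho> * G (\<phi> x0)"
        using False assms(5) G(2) \<phi>_nonneg[OF x0] by (intro mult_right_mono) auto
      also have "\<dots> \<le> \<kappa> x0"
        using \<phi>_nonneg[OF x0] assms(7) by (simp add: \<kappa>_def)
      finally show ?thesis .
    qed
    then show ?thesis
      by (simp add: exp_minus field_simps)
  qed
  then have "\<forall>x0\<in>D. solution_bounded_by f D x0 (\<lambda>t. exp (- \<omega> * t) * \<kappa> x0)"
    using gas by (simp add: solution_bounded_by_def)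
  with size \<open>\<kappa> 0 = 0\<close> show ?thesis
    by blast
qed

end
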